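(* $\mathrm{Graham}(2) < 2\uparrow\uparrow\uparrow 5$.
   Context: For $d\in\mathbb Z_+$ (positive integers), $\mathrm{Graham}(d)$ is the smallest dimension $k$ such that for every 2-coloring of the edges of the complete graph whose vertex set is $\{\pm 1\}^k$ there exists an injective function $\rho=(\rho_1,\dots,\rho_k):\{\pm 1\}^d\to\{\pm 1\}^k$ such that (i) for every $1\le i\le k$ one of the following holds: there is $1\le j\le d$ with $\rho_i(y_1,\dots,y_d)=y_j$ for all $y\in\{\pm1\}^d$; or there is $1\le j\le d$ with $\rho_i(y_1,\dots,y_d)=-y_j$ for all $y\in\{\pm1\}^d$; or $\rho_i$ is constant, equal to some element of $\{\pm1\}$; and (ii) all edges between the points of $\rho(\{\pm 1\}^d)$ have the same color. (Such a $k$ is known to exist. In particular, $\mathrm{Graham}(2)$ is the smallest integer $k$ such that every 2-coloring of the edges of the complete graph on $\{\pm1\}^k$ contains four coplanar vertices all six edges between which have the same color.) Knuth's up-arrow notation: for positive integers $a,m$, $a\uparrow\uparrow 1=a$ and $a\uparrow\uparrow(m+1)=a^{a\uparrow\uparrow m}$; $a\uparrow\uparrow\uparrow 1=a$ and $a\uparrow\uparrow\uparrow(m+1)=a\uparrow\uparrow(a\uparrow\uparrow\uparrow m)$. *)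

theory Defs
  imports "HOL-Library.Ramsey"
begin

definition cube :: "nat \<Rightarrow> (nat \<Rightarrow> int) set" where
  "cube k = {1..k} \<rightarrow>\<^sub>E {-1, 1}"

definition cube_embedding :: "nat \<Rightarrow> nat \<Rightarrow> ((nat \<Rightarrow> int) \<Rightarrow> (nat \<Rightarrow> int)) \<Rightarrow> bool" where
  "cube_embedding d k \<rho> \<longleftrightarrow>
     \<rho> \<in> cube d \<rightarrow> cube k \<and> inj_on \<rho> (cube d) \<and>
     (\<forall>i\<in>{1..k}.
        (\<exists>j\<in>{1..d}. \<forall>y\<in>cube d. \<rho> y i = y j) \<or>
        (\<exists>j\<in>{1..d}. \<forall>y\<in>cube d. \<rho> y i = - y j) \<or>
        (\<exists>s\<in>{-1, 1}. \<forall>y\<in>cube d. \<rho> y i = s))"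

text \<open>The edges of the complete graph on a vertex set \<open>V\<close> are its two-element subsets
  \<open>nsets V 2\<close>; the two colors are the elements of \<^typ>\<open>bool\<close>. Values of \<open>c\<close> on sets
  that are not edges are irrelevant.\<close>

definition graham_dim :: "nat \<Rightarrow> nat \<Rightarrow> bool" where
  "graham_dim d k \<longleftrightarrow>
     (\<forall>c :: (nat \<Rightarrow> int) set \<Rightarrow> bool.
        \<exists>\<rho>. cube_embedding d k \<rho> \<and> (\<exists>b. \<forall>e\<in>nsets (\<rho> ` cube d) 2. c e = b))"

text \<open>If no suitable dimension existed, the value below would be unspecified rather than 0,
  so an upper bound on it cannot be obtained without exhibiting a suitable dimension.\<close>

definition Graham :: "nat \<Rightarrow> nat" where
  "Graham d = (LEAST k. graham_dim d k)"

text \<open>Knuth's arrows are usually started at height 1. Starting them at height 0 with value 1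
  gives the same values at positive heights, as the lemmas show.\<close>

primrec tetration :: "nat \<Rightarrow> nat \<Rightarrow> nat" (infixr "\<up>\<up>" 80) where
  "a \<up>\<up> 0 = 1"
| "a \<up>\<up> (Suc m) = a ^ (a \<up>\<up> m)"

primrec pentation :: "nat \<Rightarrow> nat \<Rightarrow> nat" (infixr "\<up>\<up>\<up>" 80) where
  "a \<up>\<up>\<up> 0 = 1"
| "a \<up>\<up>\<up> (Suc m) = a \<up>\<up> (a \<up>\<up>\<up> m)"

lemma tetration_1: "a \<up>\<up> 1 = a"
  by simp

lemma tetration_add_1: "a \<up>\<up> (m + 1) = a ^ (a \<up>\<up> m)"
  by simp

lemma pentation_1: "a \<up>\<up>\<up> 1 = a"
  by simp

lemma pentation_add_1: "a \<up>\<up>\<up> (m + 1) = a \<up>\<up> (a \<up>\<up>\<up> m)"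
  by simp

end

theory Submission
  imports Defs
begin

text \<open>
  Write the points of the cube as bit lists. An edge \<open>{x, y}\<close> is a word over the four letters
  \<open>(x\<^sub>i, y\<^sub>i)\<close>, and a plane \<open>\<rho>\<close> has six edges: two in each parameter direction and two diagonals.

  The first idea is to merge the letters \<open>(0,0)\<close> and \<open>(1,1)\<close>, as in Shelah's proof of the
  Hales-Jewett theorem. By the pigeonhole principle, a sufficiently long block of coordinates
  contains two threshold words \<open>1\<dots>10\<dots>0\<close> that are interchangeable wherever both
  endpoints of an edge use the same word in that block. Replacing \<open>n\<close> blocks of rapidly growing
  lengths by single coordinates in this way gives an \<open>n\<close>-dimensional subcube in which the color
  of an edge depends only on the difference of its endpoints, a vector with entries
  \<open>-1, 0, 1\<close> (\<open>difference_coloring\<close>). In such a subcube, if \<open>A\<close> and \<open>B\<close> are nonzero difference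
  vectors with disjoint supports, then the plane with directions \<open>A\<close> and \<open>B\<close> has edges of only
  four kinds, namely \<open>A\<close>, \<open>B\<close>, \<open>A + B\<close> and \<open>A - B\<close>. It remains to give these four vectors the
  same color (\<open>monochromatic_plane\<close>).

  For this it suffices to look at step vectors, which are constant on the intervals between
  a few breakpoints. Seven words of values matter:
  \<open>+\<close>, \<open>+-\<close>, \<open>+-+\<close>, \<open>+-+-\<close>, \<open>+0+\<close>, \<open>+0-\<close> and \<open>+0+-\<close>.
  Ramsey's theorem (\<open>ramsey_homogeneous\<close>) gives six breakpoints such that the color of a step
  vector with one of these words depends only on the word, not on which of the six
  breakpoints are used. Each choice of \<open>A\<close> and \<open>B\<close> forbids that
  the words of its four vectors have one color, and seven such choices are already
  contradictory (\<open>exists_monochromatic_plane\<close>):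

    \<^item> \<open>+\<close> and \<open>+-\<close> have different colors, say red and blue.
    \<^item> If \<open>+-+-\<close> is blue, then \<open>+0+-\<close> and \<open>+0-\<close> are red because neither can be
      blue together with \<open>+-\<close> and \<open>+-+-\<close>; but \<open>+\<close>, \<open>+0+-\<close>, \<open>+0-\<close> cannot all be red.
    \<^item> If \<open>+-+-\<close> is red, then \<open>+0+\<close> and \<open>+-+\<close> are blue because neither can be
      red together with \<open>+\<close> and \<open>+-+-\<close>; but \<open>+0+\<close>, \<open>+-\<close>, \<open>+-+\<close> cannot all be blue.

  Each of the five rounds of the Ramsey argument costs a bounded number of exponentiations, so
  \<open>n \<le> 2 \<up>\<up> 23\<close>. Each of the \<open>n\<close> blocks costs three more, so the
  dimension is at most \<open>2 \<up>\<up> (2 \<up>\<up> 24)\<close> (\<open>Graham_2_le\<close>). This is below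
  \<open>2 \<up>\<up>\<up> 5 = 2 \<up>\<up> (2 \<up>\<up> 65536)\<close>.
\<close>

section \<open>Parametrized subcubes as maps on bit lists\<close>

text \<open>The three kinds of coordinate functions allowed in an embedding: \<open>x ! j = True\<close> is the
  \<open>j\<close>-th coordinate and \<open>x ! j = False\<close> its negation. Only lists of length \<open>n\<close> are points.\<close>

definition literal :: "nat \<Rightarrow> (bool list \<Rightarrow> bool) \<Rightarrow> bool" where
  "literal n g \<longleftrightarrow>
     (\<exists>b. \<forall>x. length x = n \<longrightarrow> g x = b) \<or>
     (\<exists>j<n. \<exists>s. \<forall>x. length x = n \<longrightarrow> g x = (x ! j = s))"

definition subcube_map :: "nat \<Rightarrow> nat \<Rightarrow> (bool list \<Rightarrow> bool list) \<Rightarrow> bool" where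
  "subcube_map n k \<phi> \<longleftrightarrow>
     (\<forall>x. length x = n \<longrightarrow> length (\<phi> x) = k) \<and>
     inj_on \<phi> {x. length x = n} \<and>
     (\<forall>i<k. literal n (\<lambda>x. \<phi> x ! i))"

lemma subcube_map_length: "subcube_map n k \<phi> \<Longrightarrow> length x = n \<Longrightarrow> length (\<phi> x) = k"
  by (simp add: subcube_map_def)

lemma subcube_map_eq_iff:
  "subcube_map n k \<phi> \<Longrightarrow> length x = n \<Longrightarrow> length y = n \<Longrightarrow> \<phi> x = \<phi> y \<longleftrightarrow> x = y"
  by (auto simp: subcube_map_def inj_on_def)

lemma literal_compose:
  assumes g: "literal n g" and len: "\<And>x. length x = d \<Longrightarrow> length (\<psi> x) = n"
    and \<psi>: "\<And>i. i < n \<Longrightarrow> literal d (\<lambda>x. \<psi> x ! i)"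
  shows "literal d (\<lambda>x. g (\<psi> x))"
proof -
  from g consider b where "\<And>z. length z = n \<Longrightarrow> g z = b"
    | j s where "j < n" "\<And>z. length z = n \<Longrightarrow> g z = (z ! j = s)"
    unfolding literal_def by blast
  then show ?thesis
  proof cases
    case 1
    then have "\<forall>x. length x = d \<longrightarrow> g (\<psi> x) = b" using len by simp
    then show ?thesis unfolding literal_def by blast
  next
    case 2
    note j = this
    from \<psi>[OF \<open>j < n\<close>] consider b where "\<And>x. length x = d \<Longrightarrow> \<psi> x ! j = b"
      | l t where "l < d" "\<And>x. length x = d \<Longrightarrow> \<psi> x ! j = (x ! l = t)"
      unfolding literal_def by blast
    then show ?thesis
    proof cases
      case 1
      then have "\<forall>x. length x = d \<longrightarrow> g (\<psi> x) = (b = s)" using len j by simp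
      then show ?thesis unfolding literal_def by blast
    next
      case 2
      then have "\<forall>x. length x = d \<longrightarrow> g (\<psi> x) = (x ! l = (t = s))"
        using len j by auto
      then show ?thesis using \<open>l < d\<close> unfolding literal_def by blast
    qed
  qed
qed

lemma subcube_map_compose:
  assumes "subcube_map n k \<phi>" "subcube_map d n \<psi>"
  shows "subcube_map d k (\<lambda>x. \<phi> (\<psi> x))"
  unfolding subcube_map_def
proof (intro conjI allI impI)
  show "length (\<phi> (\<psi> x)) = k" if "length x = d" for x
    using assms that by (simp add: subcube_map_def)
  show "inj_on (\<lambda>x. \<phi> (\<psi> x)) {x. length x = d}"
    using assms by (intro inj_onI)
      (simp add: subcube_map_eq_iff[OF assms(1)] subcube_map_eq_iff[OF assms(2)]
        subcube_map_length[OF assms(2)])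
  fix i assume "i < k"
  show "literal d (\<lambda>x. \<phi> (\<psi> x) ! i)"
    by (rule literal_compose[where g = "\<lambda>z. \<phi> z ! i" and \<psi> = \<psi> and n = n])
      (use assms \<open>i < k\<close> in \<open>auto simp: subcube_map_def\<close>)
qed

definition sign_vector :: "nat \<Rightarrow> bool list \<Rightarrow> (nat \<Rightarrow> int)" where
  "sign_vector k x = (\<lambda>i\<in>{1..k}. if x ! (i - 1) then 1 else -1)"

lemma sign_vector_in_cube: "sign_vector k x \<in> cube k"
  by (auto simp: sign_vector_def cube_def)

lemma sign_vector_inj:
  assumes "sign_vector k x = sign_vector k y" "length x = k" "length y = k"
  shows "x = y"
proof (rule nth_equalityI)
  fix i assume "i < length x"
  then show "x ! i = y ! i"
    using fun_cong[OF assms(1), of "Suc i"] assms(2,3)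
    by (auto simp: sign_vector_def split: if_splits)
qed (use assms in simp)

definition bits :: "nat \<Rightarrow> (nat \<Rightarrow> int) \<Rightarrow> bool list" where
  "bits d y = map (\<lambda>j. y (Suc j) = 1) [0..<d]"

lemma length_bits [simp]: "length (bits d y) = d"
  by (simp add: bits_def)

text \<open>The passage from bit lists, indexed from 0, to sign vectors, indexed from 1. All later
  constructions concatenate or recurse on points, which is convenient only for lists.\<close>

lemma cube_embedding_of_subcube_map:
  assumes "subcube_map d k \<phi>"
  shows "cube_embedding d k (\<lambda>y. sign_vector k (\<phi> (bits d y)))"
  unfolding cube_embedding_def
proof (intro conjI ballI)
  show "(\<lambda>y. sign_vector k (\<phi> (bits d y))) \<in> cube d \<rightarrow> cube k"
    by (auto simp: sign_vector_in_cube)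
  show "inj_on (\<lambda>y. sign_vector k (\<phi> (bits d y))) (cube d)"
  proof (rule inj_onI)
    fix y z assume yz: "y \<in> cube d" "z \<in> cube d"
      and eq: "sign_vector k (\<phi> (bits d y)) = sign_vector k (\<phi> (bits d z))"
    have "\<phi> (bits d y) = \<phi> (bits d z)"
      using sign_vector_inj[OF eq] subcube_map_length[OF assms] by simp
    then have bits: "bits d y = bits d z"
      using subcube_map_eq_iff[OF assms] by simp
    show "y = z"
    proof (rule PiE_ext[OF yz[unfolded cube_def]])
      fix i assume i: "i \<in> {1..d}"
      then have "bits d u ! (i - 1) = (u i = 1)" for u
        by (auto simp: bits_def)
      then have "(y i = 1) = (z i = 1)" using bits by metis
      moreover have "y i \<in> {-1, 1}" "z i \<in> {-1, 1}"
        using yz i unfolding cube_def by (metis PiE_mem)+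
      ultimately show "y i = z i" by auto
    qed
  qed
  fix i assume i: "i \<in> {1..k}"
  then have "literal d (\<lambda>x. \<phi> x ! (i - 1))"
    using assms by (auto simp: subcube_map_def)
  then consider b where "\<And>x. length x = d \<Longrightarrow> \<phi> x ! (i - 1) = b"
    | j s where "j < d" "\<And>x. length x = d \<Longrightarrow> \<phi> x ! (i - 1) = (x ! j = s)"
    unfolding literal_def by blast
  then show "(\<exists>j\<in>{1..d}. \<forall>y\<in>cube d. sign_vector k (\<phi> (bits d y)) i = y j) \<or>
    (\<exists>j\<in>{1..d}. \<forall>y\<in>cube d. sign_vector k (\<phi> (bits d y)) i = - y j) \<or>
    (\<exists>s\<in>{-1, 1}. \<forall>y\<in>cube d. sign_vector k (\<phi> (bits d y)) i = s)"
  proof cases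
    case 1
    then show ?thesis using i by (auto simp: sign_vector_def)
  next
    case 2
    have "y (Suc j) = 1 \<or> y (Suc j) = -1" if "y \<in> cube d" for y
      using PiE_mem[OF that[unfolded cube_def], of "Suc j"] \<open>j < d\<close> by auto
    then have "\<forall>y\<in>cube d. sign_vector k (\<phi> (bits d y)) i = (if s then 1 else -1) * y (Suc j)"
      using 2 i by (fastforce simp: sign_vector_def bits_def)
    moreover have "Suc j \<in> {1..d}" using \<open>j < d\<close> by simp
    ultimately show ?thesis by (cases s) force+
  qed
qed

section \<open>Making the color depend on differences only\<close>

text \<open>The pairs \<open>(x, y)\<close> and \<open>(x', y')\<close> have equal differences in \<open>{-1, 0, 1}\<close> coordinatewise: a
  coordinate is either literally the same in both pairs, or has difference 0 in both.\<close>

definition same_difference :: "bool list \<Rightarrow> bool list \<Rightarrow> bool list \<Rightarrow> bool list \<Rightarrow> bool" where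
  "same_difference x y x' y' \<longleftrightarrow> (\<forall>j<length x.
     x ! j = x' ! j \<and> y ! j = y' ! j \<or> x ! j = y ! j \<and> x' ! j = y' ! j)"

text \<open>The dimension in which \<open>m\<close> simultaneous 2-colorings of edges admit an \<open>n\<close>-dimensional
  subcube where all of them depend on differences only. The length of the first block is the
  number of \<open>m\<close>-tuples of 2-colorings of the pairs of points behind it.
  Fixing the values of the first coordinate at the two endpoints splits each coloring of the
  rest into four, which explains \<open>4 * m\<close>.\<close>

fun diff_length :: "nat \<Rightarrow> nat \<Rightarrow> nat" where
  "diff_length 0 m = 0"
| "diff_length (Suc n) m = 2 ^ (m * 4 ^ diff_length n (4 * m)) + diff_length n (4 * m)"

text \<open>There are \<open>l + 1\<close> threshold words of length \<open>l\<close>, but only \<open>l\<close> possible sets of contexts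
  \<open>(i, s, t)\<close> that get the color \<open>True\<close> when both endpoints carry the same word.
  Threshold words are used because two of them differ on an interval where one is all \<open>True\<close>
  and the other all \<open>False\<close>: together they form a one-parameter subcube.\<close>

lemma threshold_coincidence:
  fixes c :: "nat \<Rightarrow> bool list \<Rightarrow> bool list \<Rightarrow> bool"
  defines "e \<equiv> \<lambda>l j. replicate j True @ replicate (l - j) False"
  assumes l: "l = 2 ^ (m * 4 ^ L)"
  shows "\<exists>j1 j2. j1 < j2 \<and> j2 \<le> l \<and> (\<forall>i s t. i < m \<longrightarrow> length s = L \<longrightarrow> length t = L \<longrightarrow>
    c i (e l j1 @ s) (e l j1 @ t) = c i (e l j2 @ s) (e l j2 @ t))"
proof -
  define D where "D = {..<m} \<times> {s::bool list. length s = L} \<times> {t::bool list. length t = L}"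
  define G where "G j = {(i, s, t) \<in> D. c i (e l j @ s) (e l j @ t)}" for j
  have lists: "finite {s::bool list. length s = L}" "card {s::bool list. length s = L} = 2 ^ L"
    using finite_lists_length_eq[of "UNIV :: bool set" L]
      card_lists_length_eq[of "UNIV :: bool set" L] by simp_all
  have fin: "finite D" unfolding D_def using lists by simp
  have "card D = m * 4 ^ L"
    unfolding D_def using lists by (simp add: card_cartesian_product flip: power_mult_distrib)
  then have "card (Pow D) = l" using fin l by (simp add: card_Pow)
  moreover have "G ` {..l} \<subseteq> Pow D" by (auto simp: G_def)
  ultimately have "\<not> inj_on G {..l}"
    using card_inj_on_le[of G "{..l}" "Pow D"] fin by auto
  then obtain a b where "a \<le> l" "b \<le> l" "a \<noteq> b" "G a = G b"
    by (auto simp: inj_on_def)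
  then obtain j1 j2 where j: "j1 < j2" "j2 \<le> l" "G j1 = G j2"
    by (metis linorder_neqE_nat)
  have "c i (e l j1 @ s) (e l j1 @ t) = c i (e l j2 @ s) (e l j2 @ t)"
    if "i < m" "length s = L" "length t = L" for i s t
  proof -
    have "(i, s, t) \<in> G j1 \<longleftrightarrow> (i, s, t) \<in> G j2" using j by simp
    then show ?thesis using that by (simp add: G_def D_def)
  qed
  then show ?thesis using j by blast
qed

text \<open>In the induction step the first block is reduced to the two coinciding threshold words, one for
  each value of the new coordinate. The rest is handled by the induction hypothesis for the
  colorings indexed by \<open>(i, a, b)\<close>, where \<open>a\<close> and \<open>b\<close> are the values of the new coordinate at the
  two endpoints. This settles differences behind the first coordinate; where the first
  coordinate itself changes with \<open>a = b\<close>, the coincidence applies.\<close>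

lemma difference_coloring:
  fixes c :: "nat \<Rightarrow> bool list \<Rightarrow> bool list \<Rightarrow> bool"
  shows "\<exists>\<phi>. subcube_map n (diff_length n m) \<phi> \<and>
    (\<forall>i x y x' y'. i < m \<longrightarrow> length x = n \<longrightarrow> length y = n \<longrightarrow> length x' = n \<longrightarrow> length y' = n \<longrightarrow>
      same_difference x y x' y' \<longrightarrow> c i (\<phi> x) (\<phi> y) = c i (\<phi> x') (\<phi> y'))"
proof (induction n arbitrary: m c)
  case 0
  show ?case by (rule exI[of _ "\<lambda>x. []"]) (auto simp: subcube_map_def inj_on_def)
next
  case (Suc n)
  define L where "L = diff_length n (4 * m)"
  define l :: nat where "l = 2 ^ (m * 4 ^ L)"
  define e where "e j = replicate j True @ replicate (l - j) False" for j
  obtain j1 j2 where j: "j1 < j2" "j2 \<le> l" and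
    eq: "\<And>i s t. \<lbrakk>i < m; length s = L; length t = L\<rbrakk> \<Longrightarrow>
      c i (e j1 @ s) (e j1 @ t) = c i (e j2 @ s) (e j2 @ t)"
    using threshold_coincidence[OF l_def, of c] unfolding e_def by blast
  define E where "E a = (if a then e j2 else e j1)" for a
  have length_E: "length (E a) = l" for a
    using j by (simp add: E_def e_def)
  have E_inj: "E a = E b \<longleftrightarrow> a = b" for a b
  proof -
    have "e j1 ! j1 \<noteq> e j2 ! j1" using j by (simp add: e_def nth_append)
    then show ?thesis by (auto simp: E_def)
  qed
  have E_nth: "E a ! i = (if i < j1 then True else if i < j2 then a else False)" if "i < l" for a i
    using that j by (auto simp: E_def e_def nth_append)
  \<comment> \<open>The triple \<open>(i, a, b)\<close> is coded as \<open>k = 4 * i + 2 * a + b\<close>.\<close>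
  define c' where "c' k s t = c (k div 4) (E (k mod 4 \<ge> 2) @ s) (E (odd k) @ t)" for k s t
  obtain \<phi> where \<phi>: "subcube_map n L \<phi>"
    and hom: "\<And>k x y x' y'. \<lbrakk>k < 4 * m; length x = n; length y = n; length x' = n; length y' = n;
      same_difference x y x' y'\<rbrakk> \<Longrightarrow> c' k (\<phi> x) (\<phi> y) = c' k (\<phi> x') (\<phi> y')"
    using Suc.IH[of "4 * m" c'] unfolding L_def by blast
  define \<phi>' where "\<phi>' z = E (hd z) @ \<phi> (tl z)" for z
  have L': "diff_length (Suc n) m = l + L" by (simp add: l_def L_def)
  have "subcube_map (Suc n) (l + L) \<phi>'"
    unfolding subcube_map_def
  proof (intro conjI allI impI)
    show "length (\<phi>' z) = l + L" if "length z = Suc n" for z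
      using that by (simp add: \<phi>'_def length_E subcube_map_length[OF \<phi>])
    show "inj_on \<phi>' {x. length x = Suc n}"
    proof (rule inj_onI)
      fix u v assume "u \<in> {x. length x = Suc n}" "v \<in> {x. length x = Suc n}" and eq': "\<phi>' u = \<phi>' v"
      then obtain a x b y where uv: "u = a # x" "v = b # y" and len: "length x = n" "length y = n"
        by (auto simp: length_Suc_conv)
      from eq' have "E a = E b" "\<phi> x = \<phi> y" by (simp_all add: \<phi>'_def uv length_E)
      then show "u = v" using len by (simp add: uv E_inj subcube_map_eq_iff[OF \<phi>])
    qed
    fix i assume i: "i < l + L"
    show "literal (Suc n) (\<lambda>x. \<phi>' x ! i)"
    proof (cases "i < l")
      case True
      then have nth: "\<phi>' z ! i = (if i < j1 then True else if i < j2 then hd z else False)" for z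
        by (simp add: \<phi>'_def nth_append length_E E_nth)
      have "literal (Suc n) (\<lambda>x. hd x)"
        unfolding literal_def
        by (rule disjI2, rule exI[of _ 0], simp, rule exI[of _ True]) (auto simp: length_Suc_conv)
      moreover have "literal (Suc n) (\<lambda>x. b)" for b by (auto simp: literal_def)
      ultimately show ?thesis unfolding nth by (cases "i < j1"; cases "i < j2") simp_all
    next
      case False
      then have nth: "\<phi>' z ! i = \<phi> (tl z) ! (i - l)" for z
        by (simp add: \<phi>'_def nth_append length_E)
      have "i - l < L" using i False by simp
      then have "literal n (\<lambda>x. \<phi> x ! (i - l))"
        using \<phi> by (simp add: subcube_map_def)
      then show ?thesis unfolding nth
        by (rule literal_compose) (auto simp: literal_def nth_tl)
    qed
  qed
  moreover have "c i (\<phi>' u) (\<phi>' v) = c i (\<phi>' u') (\<phi>' v')"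
    if i: "i < m" and len: "length u = Suc n" "length v = Suc n" "length u' = Suc n" "length v' = Suc n"
      and same: "same_difference u v u' v'" for i u v u' v'
  proof -
    obtain a x b y a' x' b' y' where uv: "u = a # x" "v = b # y" "u' = a' # x'" "v' = b' # y'"
      using len by (auto simp: length_Suc_conv)
    have head: "a = a' \<and> b = b' \<or> a = b \<and> a' = b'" and tail: "same_difference x y x' y'"
      using same unfolding uv same_difference_def by (auto simp: All_less_Suc2)
    have len': "length x = n" "length y = n" "length x' = n" "length y' = n"
      using len uv by auto
    define k where "k = 4 * i + (2 * of_bool a + of_bool b)"
    have k: "k div 4 = i" "(k mod 4 \<ge> 2) = a" "odd k = b"
      by (cases a; cases b; simp add: k_def; presburger)+
    have "k < 4 * m" using i by (cases a; cases b; simp add: k_def)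
    then have "c i (E a @ \<phi> x) (E b @ \<phi> y) = c i (E a @ \<phi> x') (E b @ \<phi> y')"
      using hom[OF _ len' tail, of k] unfolding c'_def k by blast
    also have "\<dots> = c i (E a' @ \<phi> x') (E b' @ \<phi> y')"
      using head eq[OF i, of "\<phi> x'" "\<phi> y'"] subcube_map_length[OF \<phi>] len'
      by (auto simp: E_def)
    finally show ?thesis by (simp add: \<phi>'_def uv)
  qed
  ultimately show ?case unfolding L' by blast
qed

section \<open>An explicit Ramsey bound\<close>

text \<open>The Erdos-Rado argument, for colorings of finite subsets of all sizes at once: first make the
  color of a set independent of its maximum, then replace the maximum by a fixed large
  element and repeat with the remaining set, which is smaller by one.\<close>

lemma large_fiber:
  assumes "finite X" "finite K" "G ` X \<subseteq> K" "card K * k < card X"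
  shows "\<exists>v. k < card {x \<in> X. G x = v}"
proof (rule ccontr)
  assume "\<nexists>v. k < card {x \<in> X. G x = v}"
  then have "(\<Sum>v\<in>K. card {x \<in> X. G x = v}) \<le> card K * k"
    using sum_bounded_above[of K "\<lambda>v. card {x \<in> X. G x = v}" k] by (auto simp: not_less)
  moreover have "X = (\<Union>v\<in>K. {x \<in> X. G x = v})" using assms by auto
  then have "card X \<le> (\<Sum>v\<in>K. card {x \<in> X. G x = v})"
    using card_UN_le[OF assms(2), of "\<lambda>v. {x \<in> X. G x = v}"] by simp
  ultimately show False using assms by simp
qed

text \<open>The set \<open>Y\<close> is chosen one element at a time. The elements \<open>Z\<close> already chosen
  split the candidates into classes according to the colors of the sets \<open>insert y S\<close> with
  \<open>S \<subseteq> Z\<close>; there are at most \<open>q\<close> classes as long as \<open>card Z \<le> p\<close>. Continuing inside a large class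
  makes the color independent of \<open>y\<close>, and its minimum is the next element. Each
  step therefore costs a factor of \<open>q\<close> and one element, which \<open>q + 1\<close> covers.\<close>

lemma end_homogeneous_extension:
  fixes F :: "'a::linorder set \<Rightarrow> 'c"
  assumes K: "finite K" "range F \<subseteq> K" and q: "q = card K ^ 2 ^ p"
  shows "\<lbrakk>finite Z; finite X; card Z + t \<le> p; (q + 1) ^ t \<le> card X; \<forall>z\<in>Z. \<forall>x\<in>X. z < x\<rbrakk>
    \<Longrightarrow> \<exists>Y\<subseteq>X. card Y = t \<and> (\<forall>S y y'. S \<subseteq> Z \<union> Y \<longrightarrow> y \<in> Y \<longrightarrow> y' \<in> Y \<longrightarrow>
      (\<forall>s\<in>S. s < y \<and> s < y') \<longrightarrow> F (insert y S) = F (insert y' S))"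
proof (induction t arbitrary: Z X)
  case 0
  show ?case by (rule exI[of _ "{}"]) auto
next
  case (Suc t)
  note finZ = Suc.prems(1) and finX = Suc.prems(2)
  define G where "G y = (\<lambda>S\<in>Pow Z. F (insert y S))" for y
  define Q where "Q = Pow Z \<rightarrow>\<^sub>E K"
  have "card K > 0" using K by (auto simp: card_gt_0_iff)
  have "card Q = card K ^ 2 ^ card Z"
    unfolding Q_def using finZ by (simp add: card_PiE card_Pow)
  also have "\<dots> \<le> q" unfolding q using Suc.prems(3) \<open>card K > 0\<close> by (intro power_increasing) auto
  finally have cQ: "card Q \<le> q" .
  have finQ: "finite Q" unfolding Q_def using finZ K by (intro finite_PiE) auto
  have GQ: "G ` X \<subseteq> Q" unfolding G_def Q_def using K by (intro image_subsetI restrict_PiE_iff[THEN iffD2]) auto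
  have "card Q * (q + 1) ^ t \<le> q * (q + 1) ^ t" using cQ by simp
  also have "\<dots> < (q + 1) ^ Suc t" by simp
  also have "\<dots> \<le> card X" by (fact Suc.prems(4))
  finally obtain v where v: "(q + 1) ^ t < card {y \<in> X. G y = v}"
    using large_fiber[OF finX finQ GQ] by blast
  define X1 where "X1 = {y \<in> X. G y = v}"
  have finX1: "finite X1" using finX by (simp add: X1_def)
  have "card X1 \<noteq> 0" using v by (simp add: X1_def)
  then have "X1 \<noteq> {}" by auto
  define x where "x = Min X1"
  have x: "x \<in> X1" "\<And>y. y \<in> X1 \<Longrightarrow> x \<le> y"
    using finX1 \<open>X1 \<noteq> {}\<close> by (auto simp: x_def)
  have fiber: "F (insert y S) = F (insert y' S)" if "S \<subseteq> Z" "y \<in> X1" "y' \<in> X1" for S y y'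
  proof -
    have "G y S = G y' S" using that by (simp add: X1_def)
    then show ?thesis using that by (simp add: G_def)
  qed
  have "\<exists>Y\<subseteq>X1 - {x}. card Y = t \<and> (\<forall>S y y'. S \<subseteq> insert x Z \<union> Y \<longrightarrow> y \<in> Y \<longrightarrow> y' \<in> Y \<longrightarrow>
      (\<forall>s\<in>S. s < y \<and> s < y') \<longrightarrow> F (insert y S) = F (insert y' S))"
  proof (rule Suc.IH)
    show "finite (insert x Z)" "finite (X1 - {x})" using finZ finX1 by auto
    show "card (insert x Z) + t \<le> p" using Suc.prems(3) finZ by (simp add: card_insert_if)
    show "(q + 1) ^ t \<le> card (X1 - {x})" using v x by (simp add: X1_def)
    show "\<forall>z\<in>insert x Z. \<forall>y\<in>X1 - {x}. z < y"
      using Suc.prems(5) x by (auto simp: X1_def less_le)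
  qed
  then obtain Y where Y: "Y \<subseteq> X1 - {x}" "card Y = t"
    and hom: "\<And>S y y'. \<lbrakk>S \<subseteq> insert x Z \<union> Y; y \<in> Y; y' \<in> Y; \<forall>s\<in>S. s < y \<and> s < y'\<rbrakk>
      \<Longrightarrow> F (insert y S) = F (insert y' S)"
    by blast
  have YX: "insert x Y \<subseteq> X1" and "x \<notin> Y" using Y x by auto
  have "finite Y" using Y finX1 by (meson finite_Diff finite_subset)
  show ?case
  proof (intro exI[of _ "insert x Y"] conjI allI impI)
    show "insert x Y \<subseteq> X" using YX by (auto simp: X1_def)
    show "card (insert x Y) = Suc t" using \<open>x \<notin> Y\<close> \<open>finite Y\<close> Y by simp
    fix S y y' assume S: "S \<subseteq> Z \<union> insert x Y" and y: "y \<in> insert x Y" "y' \<in> insert x Y"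
      and less: "\<forall>s\<in>S. s < y \<and> s < y'"
    show "F (insert y S) = F (insert y' S)"
    proof (cases "y = x \<or> y' = x")
      case True
      then have "\<forall>s\<in>S. s < x" using less by auto
      moreover have "\<forall>s\<in>insert x Y. x \<le> s" using YX x(2) by blast
      ultimately have "S \<subseteq> Z" using S by (meson Un_iff leD subset_eq)
      then show ?thesis using y YX by (intro fiber) auto
    next
      case False
      then show ?thesis using hom[of S y y'] S y less by auto
    qed
  qed
qed

primrec ramsey_size :: "nat \<Rightarrow> nat \<Rightarrow> nat \<Rightarrow> nat" where
  "ramsey_size q h 0 = h"
| "ramsey_size q h (Suc r) = (q ^ 2 ^ (ramsey_size q h r + 1) + 1) ^ (ramsey_size q h r + 1)"

text \<open>One end-homogeneous set \<open>Y0\<close> reduces \<open>Suc r\<close> to \<open>r\<close>: the color of a nonempty \<open>S\<close> below \<open>Max Y0\<close>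
  does not change when its maximum is replaced by \<open>Max Y0\<close>, so it is determined by the
  coloring \<open>\<lambda>S. F (insert (Max Y0) S)\<close> of sets with one element less.\<close>

lemma ramsey_homogeneous:
  fixes F :: "'a::linorder set \<Rightarrow> 'c"
  assumes "finite K" "range F \<subseteq> K" "finite X" "ramsey_size (card K) h r \<le> card X"
  shows "\<exists>Y\<subseteq>X. card Y = h \<and>
    (\<forall>S T. S \<subseteq> Y \<longrightarrow> T \<subseteq> Y \<longrightarrow> card S = card T \<longrightarrow> card S \<le> r \<longrightarrow> F S = F T)"
  using assms(2-4)
proof (induction r arbitrary: F X)
  case 0
  then obtain Y where Y: "Y \<subseteq> X" "card Y = h" "finite Y"
    by (metis obtain_subset_with_card_n ramsey_size.simps(1))
  have "F S = F T" if "S \<subseteq> Y" "T \<subseteq> Y" "card S = card T" "card S \<le> 0" for S T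
    using that finite_subset[OF _ \<open>finite Y\<close>] by (metis card_0_eq le_zero_eq)
  then show ?case using Y by blast
next
  case (Suc r)
  define p where "p = ramsey_size (card K) h r + 1"
  have "\<exists>Y\<subseteq>X. card Y = p \<and> (\<forall>S y y'. S \<subseteq> {} \<union> Y \<longrightarrow> y \<in> Y \<longrightarrow> y' \<in> Y \<longrightarrow>
      (\<forall>s\<in>S. s < y \<and> s < y') \<longrightarrow> F (insert y S) = F (insert y' S))"
    by (rule end_homogeneous_extension[OF assms(1) Suc.prems(1) refl[of "card K ^ 2 ^ p"]])
      (use Suc.prems in \<open>simp_all add: p_def\<close>)
  then obtain Y0 where Y0: "Y0 \<subseteq> X" "card Y0 = p"
    and hom0: "\<And>S y y'. \<lbrakk>S \<subseteq> Y0; y \<in> Y0; y' \<in> Y0; \<forall>s\<in>S. s < y \<and> s < y'\<rbrakk>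
      \<Longrightarrow> F (insert y S) = F (insert y' S)"
    unfolding Un_empty_left by blast
  have "finite Y0" using Y0 Suc.prems(2) finite_subset by blast
  moreover have "Y0 \<noteq> {}" using Y0 by (auto simp: p_def)
  ultimately have m: "Max Y0 \<in> Y0" "\<And>y. y \<in> Y0 - {Max Y0} \<Longrightarrow> y < Max Y0"
    by (auto simp: less_le)
  have "card (Y0 - {Max Y0}) = ramsey_size (card K) h r"
    using Y0 m(1) by (simp add: p_def card_Diff_singleton)
  moreover have "range (\<lambda>S. F (insert (Max Y0) S)) \<subseteq> K" using Suc.prems(1) by auto
  moreover have "finite (Y0 - {Max Y0})" using \<open>finite Y0\<close> by simp
  ultimately obtain Y where Y: "Y \<subseteq> Y0 - {Max Y0}" "card Y = h"
    and hom: "\<And>S T. \<lbrakk>S \<subseteq> Y; T \<subseteq> Y; card S = card T; card S \<le> r\<rbrakk>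
      \<Longrightarrow> F (insert (Max Y0) S) = F (insert (Max Y0) T)"
    using Suc.IH[of "\<lambda>S. F (insert (Max Y0) S)" "Y0 - {Max Y0}"] by (metis order_refl)
  have finY: "finite S" if "S \<subseteq> Y" for S
    using that Y \<open>finite Y0\<close> by (meson finite_Diff finite_subset)
  have max_to_top: "F S = F (insert (Max Y0) (S - {Max S}))" if S: "S \<subseteq> Y" "S \<noteq> {}" for S
  proof -
    have "Max S \<in> S" "\<forall>s\<in>S - {Max S}. s < Max S"
      using S finY by (auto simp: less_le)
    moreover have "\<forall>s\<in>S. s < Max Y0" using S Y m by blast
    ultimately have "F (insert (Max S) (S - {Max S})) = F (insert (Max Y0) (S - {Max S}))"
      using S Y m(1) by (intro hom0) blast+
    then show ?thesis using \<open>Max S \<in> S\<close> by (simp add: insert_absorb)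
  qed
  have "F S = F T" if ST: "S \<subseteq> Y" "T \<subseteq> Y" "card S = card T" "card S \<le> Suc r" for S T
  proof (cases "S = {}")
    case True
    then show ?thesis using ST finY by auto
  next
    case False
    then have "T \<noteq> {}" using ST finY by auto
    have "card (S - {Max S}) = card (T - {Max T})" "card (S - {Max S}) \<le> r"
      using False \<open>T \<noteq> {}\<close> ST finY by (simp_all add: card_Diff_singleton)
    then have "F (insert (Max Y0) (S - {Max S})) = F (insert (Max Y0) (T - {Max T}))"
      using ST by (intro hom) blast+
    then show ?thesis
      using max_to_top[OF ST(1) False] max_to_top[OF ST(2) \<open>T \<noteq> {}\<close>] by simp
  qed
  then show ?case using Y Y0 by blast
qed

section \<open>Disjoint signed sets with equally colored sums\<close>

text \<open>The color of the edge from the indicator of \<open>v = 1\<close> to the indicator of \<open>v = -1\<close>. When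
  \<open>d\<close> depends on differences only, it is the color of every edge with difference \<open>v\<close>.\<close>

definition signed_color :: "nat \<Rightarrow> (bool list \<Rightarrow> bool list \<Rightarrow> bool) \<Rightarrow> (nat \<Rightarrow> int) \<Rightarrow> bool" where
  "signed_color n d v = d (map (\<lambda>j. v j = 1) [0..<n]) (map (\<lambda>j. v j = -1) [0..<n])"

definition signs :: "(nat \<Rightarrow> int) \<Rightarrow> bool" where
  "signs v \<longleftrightarrow> (\<forall>j. v j \<in> {-1, 0, 1})"

text \<open>The letters of the word are the values on the successive intervals \<open>[p\<^sub>i, p\<^sub>i\<^sub>+\<^sub>1)\<close>; the vector is 0
  outside.\<close>

fun step :: "nat list \<Rightarrow> int list \<Rightarrow> nat \<Rightarrow> int" where
  "step (p # q # ps) (a # w) j = (if p \<le> j \<and> j < q then a else step (q # ps) w j)"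
| "step _ _ j = 0"

lemma signs_step: "set w \<subseteq> {-1, 0, 1} \<Longrightarrow> signs (step ps w)"
proof -
  have "set w \<subseteq> {-1, 0, 1} \<Longrightarrow> step ps w j \<in> {-1, 0, 1}" for j
    by (induction ps w j rule: step.induct) auto
  then show "set w \<subseteq> {-1, 0, 1} \<Longrightarrow> signs (step ps w)" by (simp add: signs_def)
qed

text \<open>Parameter 0 acts on the support of \<open>A\<close> and parameter 1 on that of \<open>B\<close>, negated where the
  vector is \<open>-1\<close>. The remaining coordinates are constant.\<close>

definition plane :: "nat \<Rightarrow> (nat \<Rightarrow> int) \<Rightarrow> (nat \<Rightarrow> int) \<Rightarrow> bool list \<Rightarrow> bool list" where
  "plane n A B x = map (\<lambda>j. if A j \<noteq> 0 then x ! 0 = (A j = 1)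
     else if B j \<noteq> 0 then x ! 1 = (B j = 1) else False) [0..<n]"

lemma subcube_map_plane:
  assumes "\<exists>j<n. A j \<noteq> 0" "\<exists>j<n. B j \<noteq> 0" "\<And>j. A j = 0 \<or> B j = 0"
  shows "subcube_map 2 n (plane n A B)"
  unfolding subcube_map_def
proof (intro conjI allI impI)
  show "length (plane n A B x) = n" for x by (simp add: plane_def)
  obtain i j where ij: "i < n" "A i \<noteq> 0" "B i = 0" "j < n" "B j \<noteq> 0" "A j = 0"
    using assms by metis
  show "inj_on (plane n A B) {x. length x = 2}"
  proof (rule inj_onI)
    fix x y assume xy: "x \<in> {x. length x = 2}" "y \<in> {x. length x = 2}"
      and eq: "plane n A B x = plane n A B y"
    have "x ! 0 = y ! 0" using arg_cong[OF eq, of "\<lambda>z. z ! i"] ij by (auto simp: plane_def)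
    moreover have "x ! 1 = y ! 1" using arg_cong[OF eq, of "\<lambda>z. z ! j"] ij by (auto simp: plane_def)
    ultimately show "x = y" using xy by (auto simp: list_eq_iff_nth_eq less_2_cases_iff)
  qed
  fix i assume "i < n"
  then show "literal 2 (\<lambda>x. plane n A B x ! i)"
  proof (cases "A i \<noteq> 0")
    case True
    then have "\<forall>x. plane n A B x ! i = (x ! 0 = (A i = 1))"
      using \<open>i < n\<close> by (simp add: plane_def)
    then show ?thesis unfolding literal_def by (metis zero_less_numeral)
  next
    case A: False
    show ?thesis
    proof (cases "B i \<noteq> 0")
      case True
      then have "\<forall>x. plane n A B x ! i = (x ! 1 = (B i = 1))"
        using \<open>i < n\<close> A by (simp add: plane_def)
      then show ?thesis unfolding literal_def by (metis one_less_numeral_iff semiring_norm(76))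
    next
      case False
      then have "\<forall>x. plane n A B x ! i = False"
        using \<open>i < n\<close> A by (simp add: plane_def)
      then show ?thesis unfolding literal_def by blast
    qed
  qed
qed

locale difference_invariant_coloring =
  fixes n :: nat and d :: "bool list \<Rightarrow> bool list \<Rightarrow> bool"
  assumes sym: "d x y = d y x"
    and diff: "\<lbrakk>length x = n; length y = n; length x' = n; length y' = n; same_difference x y x' y'\<rbrakk>
      \<Longrightarrow> d x y = d x' y'"
begin

abbreviation col :: "(nat \<Rightarrow> int) \<Rightarrow> bool" where
  "col \<equiv> signed_color n d"

lemma color_eq_signed_color:
  assumes "length x = n" "length y = n"
    "\<And>j. j < n \<Longrightarrow> v j = of_bool (x ! j) - of_bool (y ! j)"
  shows "d x y = col v"
  unfolding signed_color_def
  by (rule diff) (use assms in \<open>auto simp: same_difference_def\<close>)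

text \<open>Changing the first parameter from \<open>False\<close> to \<open>True\<close> changes the point by \<open>A\<close>, whatever the second
  is; likewise for \<open>B\<close>. The diagonals have differences \<open>A + B\<close> and \<open>A - B\<close>. By symmetry of \<open>d\<close> the
  direction of an edge does not matter.\<close>

lemma monochromatic_plane:
  assumes signs: "signs A" "signs B" and disj: "\<And>j. A j = 0 \<or> B j = 0"
    and mono: "col A = b" "col B = b" "col (\<lambda>j. A j + B j) = b" "col (\<lambda>j. A j - B j) = b"
    and x: "length x = 2" and y: "length y = 2" and "x \<noteq> y"
  shows "d (plane n A B x) (plane n A B y) = b"
proof -
  have bools: "length z = 2 \<longleftrightarrow> (\<exists>s t. z = [s, t])" for z :: "bool list"
    by (auto simp: numeral_2_eq_2 length_Suc_conv)
  have val: "A j = -1 \<or> A j = 0 \<or> A j = 1" "B j = -1 \<or> B j = 0 \<or> B j = 1" for j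
    using signs by (auto simp: signs_def)
  have nz: "A j \<noteq> 0 \<Longrightarrow> B j = 0" for j using disj by blast
  have len: "length (plane n A B z) = n" for z by (simp add: plane_def)
  let ?P = "plane n A B"
  have "d (?P [True, t]) (?P [False, t]) = b" for t
    unfolding mono(1)[symmetric]
    by (rule color_eq_signed_color) (use val nz in \<open>auto simp: plane_def len\<close>)
  moreover have "d (?P [s, True]) (?P [s, False]) = b" for s
    unfolding mono(2)[symmetric]
    by (rule color_eq_signed_color) (use val nz in \<open>auto simp: plane_def len\<close>)
  moreover have "d (?P [True, True]) (?P [False, False]) = b"
    unfolding mono(3)[symmetric]
    by (rule color_eq_signed_color) (use val nz in \<open>auto simp: plane_def len\<close>)
  moreover have "d (?P [True, False]) (?P [False, True]) = b"
    unfolding mono(4)[symmetric]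
    by (rule color_eq_signed_color) (use val nz in \<open>auto simp: plane_def len\<close>)
  ultimately show ?thesis
    using x y \<open>x \<noteq> y\<close> sym unfolding bools by (metis (full_types))
qed

text \<open>Six breakpoints are needed because the second of the seven configurations below uses five
  intervals. Sets of at most five breakpoints suffice for the colors because no single
  vector in any of them has a word of more than four letters. The Ramsey color of a set of
  breakpoints is a subset of the seven words, which gives \<open>2 ^ 7 = 128\<close> colors.\<close>

lemma exists_monochromatic_plane:
  assumes size: "ramsey_size 128 6 5 \<le> n"
  shows "\<exists>\<psi> b. subcube_map 2 n \<psi> \<and>
    (\<forall>x y. length x = 2 \<longrightarrow> length y = 2 \<longrightarrow> x \<noteq> y \<longrightarrow> d (\<psi> x) (\<psi> y) = b)"
proof (rule ccontr)
  assume no_plane: "\<not> ?thesis"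
  have not_all_equal: "\<not> (col A = b \<and> col B = b \<and> col (\<lambda>j. A j + B j) = b \<and> col (\<lambda>j. A j - B j) = b)"
    if "signs A" "signs B" "\<And>j. A j = 0 \<or> B j = 0" "\<exists>j<n. A j \<noteq> 0" "\<exists>j<n. B j \<noteq> 0" for A B b
    using that no_plane monochromatic_plane[of A B b] subcube_map_plane[of n A B] by blast
  define W :: "int list set" where
    "W = {[1], [1, -1], [1, -1, 1], [1, -1, 1, -1], [1, 0, 1], [1, 0, -1], [1, 0, 1, -1]}"
  \<comment> \<open>Words whose length does not fit the number of breakpoints only refine the coloring.\<close>
  define F where "F S = {w \<in> W. col (step (sorted_list_of_set S) w)}" for S
  have "card (Pow W) = 128" by (simp add: W_def card_Pow)
  moreover have "finite (Pow W)" by (simp add: W_def)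
  moreover have "range F \<subseteq> Pow W" unfolding F_def by blast
  ultimately obtain Y where Y: "Y \<subseteq> {..<n}" "card Y = 6"
    and hom: "\<And>S T. \<lbrakk>S \<subseteq> Y; T \<subseteq> Y; card S = card T; card S \<le> 5\<rbrakk> \<Longrightarrow> F S = F T"
    using ramsey_homogeneous[of "Pow W" F "{..<n}" 6 5] size
    by (metis card_lessThan finite_lessThan)
  have finY: "finite Y" using Y(1) finite_subset by blast
  obtain p0 p1 p2 p3 p4 p5 where ps: "sorted_list_of_set Y = [p0, p1, p2, p3, p4, p5]"
  proof -
    have "\<exists>p0 p1 p2 p3 p4 p5. qs = [p0, p1, p2, p3, p4, p5]" if "length qs = 6" for qs :: "nat list"
      using that by (auto simp: eval_nat_numeral length_Suc_conv)
    moreover have "length (sorted_list_of_set Y) = 6" using Y by simp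
    ultimately show ?thesis using that by blast
  qed
  have setY: "Y = {p0, p1, p2, p3, p4, p5}"
    using arg_cong[OF ps, of set] finY by simp
  have less: "p0 < p1" "p1 < p2" "p2 < p3" "p3 < p4" "p4 < p5"
    using strict_sorted_list_of_set[of Y] unfolding ps by simp_all
  define t where "t w = (w \<in> F (set (take (length w + 1) [p0, p1, p2, p3, p4, p5])))" for w
  have col_step: "col (step qs w) = t w"
    if "w \<in> W" "sorted_wrt (<) qs" "set qs \<subseteq> Y" "length qs = length w + 1" for qs w
  proof -
    have len: "length w \<le> 4" using that(1) by (auto simp: W_def)
    let ?q0 = "take (length w + 1) [p0, p1, p2, p3, p4, p5]"
    have sorted0: "sorted_wrt (<) ?q0" using less by (intro sorted_wrt_take) simp
    have "F (set qs) = F (set ?q0)"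
    proof (rule hom)
      show "set qs \<subseteq> Y" by (fact that)
      show "set ?q0 \<subseteq> Y" unfolding setY using set_take_subset by fastforce
      have "card (set qs) = length w + 1"
        using that by (metis distinct_card strict_sorted_iff)
      moreover have "card (set ?q0) = length w + 1"
        using sorted0 len by (subst distinct_card) (auto simp: strict_sorted_iff)
      ultimately show "card (set qs) = card (set ?q0)" "card (set qs) \<le> 5" using len by auto
    qed
    then have "t w = (w \<in> F (set qs))" by (simp add: t_def)
    moreover have "sorted_list_of_set (set qs) = qs"
      using that(2) by (simp add: strict_sorted_iff sorted_list_of_set.idem_if_sorted_distinct)
    ultimately show ?thesis using that(1) by (simp add: F_def)
  qed
  have nonzero: "\<exists>j<n. step qs w j \<noteq> 0"
    if w: "w \<in> W" and qs: "sorted_wrt (<) qs" "set qs \<subseteq> Y" "length qs = length w + 1" for qs w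
  proof -
    from w obtain v where v: "w = 1 # v" by (auto simp: W_def)
    with qs(3) obtain p q qs' where "qs = p # q # qs'" by (auto simp: length_Suc_conv)
    then have "step qs w p = 1" "p < n" using qs Y(1) v by auto
    then show ?thesis by (intro exI[of _ p]) simp
  qed
  have signs: "signs (step qs w)" if "w \<in> W" for qs w
    using that by (intro signs_step) (auto simp: W_def)
  have clause: "\<not> (t w = b \<and> t v = b \<and> t u = b \<and> t z = b)"
    if W: "w \<in> W" "v \<in> W" "u \<in> W" "z \<in> W"
      and ps: "sorted_wrt (<) ps" "set ps \<subseteq> Y" "length ps = length w + 1"
      and qs: "sorted_wrt (<) qs" "set qs \<subseteq> Y" "length qs = length v + 1"
      and rs: "sorted_wrt (<) rs" "set rs \<subseteq> Y" "length rs = length u + 1"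
      and ss: "sorted_wrt (<) ss" "set ss \<subseteq> Y" "length ss = length z + 1"
      and disj: "\<And>j. step ps w j = 0 \<or> step qs v j = 0"
      and add: "\<And>j. step ps w j + step qs v j = step rs u j"
      and diff: "\<And>j. step ps w j - step qs v j = step ss z j"
    for w v u z ps qs rs ss b
    using not_all_equal[OF signs[OF W(1)] signs[OF W(2)] disj nonzero[OF W(1) ps] nonzero[OF W(2) qs], of b]
    unfolding add diff col_step[OF W(1) ps] col_step[OF W(2) qs] col_step[OF W(3) rs] col_step[OF W(4) ss] .
  \<comment> \<open>The four words belong to \<open>A\<close>, \<open>B\<close>, \<open>A + B\<close> and \<open>A - B\<close>. With one column for each interval
      between the breakpoints, \<open>A\<close> and \<open>B\<close> are: (1) \<open>+0\<close>, \<open>0+\<close>; (2) \<open>+00+-\<close>, \<open>0+-00\<close>;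
      (3) \<open>+00+\<close>, \<open>0+-0\<close>; (4) \<open>+0+0\<close>, \<open>0+0+\<close>; (5) \<open>+00-\<close>, \<open>00+0\<close>; (6) \<open>+00-\<close>, \<open>0+-0\<close>;
      (7) \<open>+-+0\<close>, \<open>000+\<close>.\<close>
  have 1: "\<not> (t [1] = b \<and> t [1] = b \<and> t [1] = b \<and> t [1, -1] = b)" for b
    by (rule clause[where ps = "[p0, p1]" and qs = "[p1, p2]" and
        rs = "[p0, p2]" and ss = "[p0, p1, p2]"])
      (use less in \<open>auto simp: W_def setY\<close>)
  have 2: "\<not> (t [1, 0, 1, -1] = b \<and> t [1, -1] = b \<and> t [1, -1, 1, -1] = b \<and> t [1, -1, 1, -1] = b)" for b
    by (rule clause[where ps = "[p0, p1, p3, p4, p5]" and qs = "[p1, p2, p3]" and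
        rs = "[p0, p2, p3, p4, p5]" and ss = "[p0, p1, p2, p4, p5]"])
      (use less in \<open>auto simp: W_def setY\<close>)
  have 3: "\<not> (t [1, 0, 1] = b \<and> t [1, -1] = b \<and> t [1, -1, 1] = b \<and> t [1, -1, 1] = b)" for b
    by (rule clause[where ps = "[p0, p1, p3, p4]" and qs = "[p1, p2, p3]" and
        rs = "[p0, p2, p3, p4]" and ss = "[p0, p1, p2, p4]"])
      (use less in \<open>auto simp: W_def setY\<close>)
  have 4: "\<not> (t [1, 0, 1] = b \<and> t [1, 0, 1] = b \<and> t [1] = b \<and> t [1, -1, 1, -1] = b)" for b
    by (rule clause[where ps = "[p0, p1, p2, p3]" and qs = "[p1, p2, p3, p4]" and
        rs = "[p0, p4]" and ss = "[p0, p1, p2, p3, p4]"])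
      (use less in \<open>auto simp: W_def setY\<close>)
  have 5: "\<not> (t [1, 0, -1] = b \<and> t [1] = b \<and> t [1, 0, 1, -1] = b \<and> t [1, 0, -1] = b)" for b
    by (rule clause[where ps = "[p0, p1, p3, p4]" and qs = "[p2, p3]" and
        rs = "[p0, p1, p2, p3, p4]" and ss = "[p0, p1, p2, p4]"])
      (use less in \<open>auto simp: W_def setY\<close>)
  have 6: "\<not> (t [1, 0, -1] = b \<and> t [1, -1] = b \<and> t [1, -1] = b \<and> t [1, -1, 1, -1] = b)" for b
    by (rule clause[where ps = "[p0, p1, p3, p4]" and qs = "[p1, p2, p3]" and
        rs = "[p0, p2, p4]" and ss = "[p0, p1, p2, p3, p4]"])
      (use less in \<open>auto simp: W_def setY\<close>)
  have 7: "\<not> (t [1, -1, 1] = b \<and> t [1] = b \<and> t [1, -1, 1] = b \<and> t [1, -1, 1, -1] = b)" for b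
    by (rule clause[where ps = "[p0, p1, p2, p3]" and qs = "[p3, p4]" and
        rs = "[p0, p1, p2, p4]" and ss = "[p0, p1, p2, p3, p4]"])
      (use less in \<open>auto simp: W_def setY\<close>)
  show False
    using 1 2 3 4 5 6 7 by (metis (full_types))
qed

end

theorem graham_dim_2: "graham_dim 2 (diff_length (ramsey_size 128 6 5) 1)"
  unfolding graham_dim_def
proof
  fix C :: "(nat \<Rightarrow> int) set \<Rightarrow> bool"
  define n where "n = ramsey_size 128 6 5"
  define k where "k = diff_length n 1"
  obtain \<phi> where \<phi>: "subcube_map n k \<phi>"
    and diff: "\<And>x y x' y'. \<lbrakk>length x = n; length y = n; length x' = n; length y' = n;
      same_difference x y x' y'\<rbrakk> \<Longrightarrow>
      C {sign_vector k (\<phi> x), sign_vector k (\<phi> y)} = C {sign_vector k (\<phi> x'), sign_vector k (\<phi> y')}"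
    using difference_coloring[of n 1 "\<lambda>_ u v. C {sign_vector k u, sign_vector k v}"]
    unfolding k_def by (metis less_one)
  interpret difference_invariant_coloring n "\<lambda>x y. C {sign_vector k (\<phi> x), sign_vector k (\<phi> y)}"
    by unfold_locales (simp add: insert_commute, rule diff)
  obtain \<psi> b where \<psi>: "subcube_map 2 n \<psi>"
    and mono: "\<And>x y. \<lbrakk>length x = 2; length y = 2; x \<noteq> y\<rbrakk> \<Longrightarrow>
      C {sign_vector k (\<phi> (\<psi> x)), sign_vector k (\<phi> (\<psi> y))} = b"
    using exists_monochromatic_plane unfolding n_def by blast
  define \<rho> where "\<rho> y = sign_vector k (\<phi> (\<psi> (bits 2 y)))" for y
  have "cube_embedding 2 k \<rho>"
    using cube_embedding_of_subcube_map[OF subcube_map_compose[OF \<phi> \<psi>]]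
    by (simp add: \<rho>_def[abs_def])
  moreover have "C e = b" if "e \<in> nsets (\<rho> ` cube 2) 2" for e
  proof -
    have "e \<subseteq> \<rho> ` cube 2" "card e = 2" using that by (simp_all add: nsets_def)
    then obtain u v where uv: "e = {u, v}" "u \<noteq> v" by (meson card_2_iff)
    with \<open>e \<subseteq> \<rho> ` cube 2\<close> obtain y z where "u = \<rho> y" "v = \<rho> z" by auto
    with uv have e: "e = {\<rho> y, \<rho> z}" "\<rho> y \<noteq> \<rho> z" by simp_all
    then have "bits 2 y \<noteq> bits 2 z" by (auto simp: \<rho>_def)
    then show ?thesis unfolding e \<rho>_def by (intro mono) simp_all
  qed
  ultimately show "\<exists>\<rho>. cube_embedding 2 (diff_length (ramsey_size 128 6 5) 1) \<rho> \<and>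
      (\<exists>b. \<forall>e\<in>nsets (\<rho> ` cube 2) 2. C e = b)"
    unfolding k_def n_def by blast
qed

section \<open>The size of the bound\<close>

lemma tetration_strict_mono: "strict_mono (\<lambda>m. 2 \<up>\<up> m)"
  by (simp add: strict_mono_Suc_iff)

lemma tetration_mono: "m \<le> m' \<Longrightarrow> 2 \<up>\<up> m \<le> 2 \<up>\<up> m'"
  using strict_mono_mono[OF tetration_strict_mono] by (simp add: monoD)

lemma less_tetration: "m < 2 \<up>\<up> m"
proof (induction m)
  case (Suc m)
  then have "Suc m \<le> 2 \<up>\<up> m" by simp
  also have "\<dots> < 2 \<up>\<up> Suc m" by (simp add: less_exp)
  finally show ?case .
qed simp

lemma linear_le_power2:
  "T \<ge> 4 \<Longrightarrow> 3 * T \<le> 2 ^ T" "T \<ge> 6 \<Longrightarrow> 8 * T \<le> 2 ^ T" "T \<ge> 7 \<Longrightarrow> 3 * T + 25 \<le> 2 ^ T" for T :: nat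
proof -
  show "3 * T \<le> 2 ^ T" if "T \<ge> 4" using that by (induction T rule: nat_induct_at_least) auto
  show "8 * T \<le> 2 ^ T" if "T \<ge> 6" using that by (induction T rule: nat_induct_at_least) auto
  show "3 * T + 25 \<le> 2 ^ T" if "T \<ge> 7" using that by (induction T rule: nat_induct_at_least) auto
qed

text \<open>One of the four levels per round absorbs the successor in the size, and with \<open>P\<close>
  the next tower above it the remaining ones come from
  \<open>(128 ^ 2 ^ P + 1) ^ P \<le> 2 ^ (8 * P * 2 ^ P) \<le> 2 ^ 2 ^ 2 ^ P\<close>.\<close>

lemma ramsey_size_le: "ramsey_size 128 6 r \<le> 2 \<up>\<up> (4 * r + 3)"
proof (induction r)
  case 0
  show ?case by (simp add: eval_nat_numeral)
next
  case (Suc r)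
  define P where "P = 2 \<up>\<up> (4 * r + 4)"
  have "ramsey_size 128 6 r < 2 \<up>\<up> (4 * r + 4)"
    using Suc strict_monoD[OF tetration_strict_mono, of "4 * r + 3" "4 * r + 4"] by linarith
  then have p: "ramsey_size 128 6 r + 1 \<le> P" by (simp add: P_def)
  have "2 \<up>\<up> 3 \<le> P" unfolding P_def by (rule tetration_mono) simp
  then have P: "P \<ge> 16" by (simp add: eval_nat_numeral)
  have "ramsey_size 128 6 (Suc r) \<le> (128 ^ 2 ^ P + 1) ^ P"
    unfolding ramsey_size.simps using p
    by (intro order_trans[OF power_increasing power_mono] add_mono power_increasing) auto
  also have "\<dots> \<le> (2 ^ (8 * 2 ^ P)) ^ P"
  proof (rule power_mono)
    have "(128::nat) ^ 2 ^ P = 2 ^ (7 * 2 ^ P)" by (simp add: power_mult)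
    moreover have "(2::nat) ^ (7 * 2 ^ P) + 1 \<le> 2 ^ (7 * 2 ^ P) * 2" by simp
    moreover have "(2::nat) ^ (7 * 2 ^ P) * 2 \<le> 2 ^ (7 * 2 ^ P) * 2 ^ 2 ^ P"
      by (intro mult_le_mono2 self_le_power) simp_all
    moreover have "(2::nat) ^ (7 * 2 ^ P) * 2 ^ 2 ^ P = 2 ^ (8 * 2 ^ P)" by (simp flip: power_add)
    ultimately show "(128::nat) ^ 2 ^ P + 1 \<le> 2 ^ (8 * 2 ^ P)" by linarith
  qed simp
  also have "\<dots> = 2 ^ (8 * P * 2 ^ P)" by (simp flip: power_mult add: mult_ac)
  also have "8 * P * 2 ^ P \<le> 2 ^ P * 2 ^ P" using linear_le_power2(2)[of P] P by simp
  also have "(2::nat) ^ P * 2 ^ P = 2 ^ (2 * P)" by (simp flip: power_add add: mult_2)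
  also have "2 * P \<le> 2 ^ P" using linear_le_power2(1)[of P] P by simp
  finally have "ramsey_size 128 6 (Suc r) \<le> 2 ^ 2 ^ 2 ^ P" by simp
  also have "\<dots> = 2 \<up>\<up> (4 * Suc r + 3)"
    by (simp add: P_def eval_nat_numeral)
  finally show ?case .
qed

text \<open>The product \<open>m * 4 ^ n\<close> is invariant under the recursion, so a single \<open>s\<close> accounts for the number
  of colorings at every level.\<close>

lemma diff_length_le:
  "\<lbrakk>2 \<le> s; m * 4 ^ n \<le> 2 \<up>\<up> s\<rbrakk> \<Longrightarrow> diff_length n m \<le> 2 \<up>\<up> (3 * n + s)"
proof (induction n arbitrary: m)
  case (Suc n)
  define L where "L = diff_length n (4 * m)"
  define T where "T = 2 \<up>\<up> (3 * n + s)"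
  have L: "L \<le> T" unfolding L_def T_def using Suc.prems by (intro Suc.IH) (simp_all add: mult_ac)
  have "m \<le> m * 4 ^ Suc n" by simp
  also have "\<dots> \<le> 2 \<up>\<up> s" by (fact Suc.prems)
  also have "\<dots> \<le> T" unfolding T_def by (rule tetration_mono) simp
  finally have m: "m \<le> T" .
  have "2 \<up>\<up> 2 \<le> T" unfolding T_def using Suc.prems by (intro tetration_mono) simp
  then have T: "T \<ge> 4" by (simp add: eval_nat_numeral)
  have "diff_length (Suc n) m = 2 ^ (m * 4 ^ L) + L" by (simp add: L_def)
  also have "\<dots> \<le> 2 ^ (T * 4 ^ T) + T"
    using L m by (intro add_mono power_increasing mult_mono) auto
  also have "\<dots> \<le> 2 ^ (T * 4 ^ T + 1)"
  proof -
    have "T \<le> T * 4 ^ T" by simp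
    also have "\<dots> < 2 ^ (T * 4 ^ T)" by (rule less_exp)
    finally show ?thesis by simp
  qed
  also have "T * 4 ^ T + 1 \<le> 2 ^ T * 4 ^ T"
  proof -
    have "T + 1 \<le> 2 ^ T" unfolding Suc_eq_plus1[symmetric] by (rule Suc_leI, rule less_exp)
    then have "(T + 1) * 4 ^ T \<le> 2 ^ T * 4 ^ T" by (rule mult_le_mono1)
    moreover have "T * 4 ^ T + 1 \<le> (T + 1) * 4 ^ T" by simp
    ultimately show ?thesis by linarith
  qed
  also have "(2::nat) ^ T * 4 ^ T = 2 ^ (3 * T)"
    using power_mult_distrib[of "2::nat" 4 T] by (simp add: power_mult)
  also have "3 * T \<le> 2 ^ T" by (rule linear_le_power2(1)[OF T])
  finally have "diff_length (Suc n) m \<le> 2 ^ 2 ^ 2 ^ T" by simp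
  also have "\<dots> = 2 \<up>\<up> (3 * Suc n + s)"
    by (simp add: T_def eval_nat_numeral)
  finally show ?case .
qed simp

theorem Graham_2_le: "Graham 2 \<le> 2 \<up>\<up> (2 \<up>\<up> 24)"
proof -
  define n where "n = ramsey_size 128 6 5"
  define T where "T = 2 \<up>\<up> 23"
  have n: "n \<le> T" using ramsey_size_le[of 5] by (simp add: n_def T_def)
  have T: "T \<ge> 24" using less_tetration[of 23] by (simp add: T_def)
  have Suc_T: "2 \<up>\<up> 24 = 2 ^ T" "2 \<up>\<up> 25 = 2 ^ 2 ^ T"
    using tetration.simps(2)[of 2 23] tetration.simps(2)[of 2 24] by (simp_all add: T_def)
  have "(1::nat) * 4 ^ n \<le> 4 ^ T" using n by (simp add: power_increasing)
  also have "\<dots> = 2 ^ (2 * T)" by (simp add: power_mult)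
  also have "\<dots> \<le> 2 \<up>\<up> 25"
    unfolding Suc_T using linear_le_power2(1)[of T] T by (intro power_increasing) auto
  finally have "diff_length n 1 \<le> 2 \<up>\<up> (3 * n + 25)"
    by (intro diff_length_le) auto
  also have "\<dots> \<le> 2 \<up>\<up> (2 \<up>\<up> 24)"
    using n linear_le_power2(3)[of T] T unfolding Suc_T by (intro tetration_mono) linarith
  finally show ?thesis
    using Least_le[of "graham_dim 2", OF graham_dim_2] by (simp add: Graham_def n_def)
qed

theorem theorem1: "Graham 2 < 2 \<up>\<up>\<up> 5"
proof -
  have "2 \<up>\<up>\<up> 2 = 4" by (simp add: numeral_2_eq_2)
  then have "2 \<up>\<up>\<up> 5 = 2 \<up>\<up> (2 \<up>\<up> (2 \<up>\<up> 4))"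
    using pentation.simps(2)[of 2 2] pentation.simps(2)[of 2 3] pentation.simps(2)[of 2 4]
    by (simp del: tetration.simps pentation.simps)
  moreover have "24 < 2 \<up>\<up> 4"
  proof -
    have "2 \<up>\<up> 3 = 16" by (simp add: eval_nat_numeral)
    then show ?thesis using tetration.simps(2)[of 2 3] by simp
  qed
  ultimately have "2 \<up>\<up> (2 \<up>\<up> 24) < 2 \<up>\<up>\<up> 5"
    using strict_monoD[OF tetration_strict_mono] by metis
  then show ?thesis using Graham_2_le by (rule le_less_trans[rotated])
qed

end
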